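(* Let $n\ge2$, let $F\subseteq\mathbb{R}^n$ be a nonempty closed convex set and let $k\ge1$. Then: (i) $F\models\rho_k$ if and only if $\dim\operatorname{rec}F\ge k$; (ii) $F\models\lambda_k$ if and only if $\dim\operatorname{lin}F\ge k$; (iii) $F\models\varepsilon$ if and only if $\operatorname{rec}F\ne\operatorname{lin}F$. Consequently $\dim\operatorname{rec}F$, $\dim\operatorname{lin}F$, and whether $\operatorname{rec}F$ is a linear subspace are determined by the $\mathcal{L}_{\mathrm{B}}$-theory of $F$; together with the affine dimension of $F$ they are elementary invariants of closed convex sets (i.e. they agree for $\mathcal{L}_{\mathrm{B}}$-elementarily equivalent nonempty closed convex sets).
   Context: $\mathcal{L}_{\mathrm{B}}$ is the first-order language with a single ternary relation symbol $B$; a convex set $K\subseteq\mathbb{R}^n$ is a structure with universe $K$, where $B(a,x,b)$ holds iff $x\in[a,b]$. For convex $F$, $\operatorname{rec}F=\{v\in\mathbb{R}^n:x+tv\in F\text{ for all }x\in F,\ t\ge0\}$, $\operatorname{lin}F=\operatorname{rec}F\cap(-\operatorname{rec}F)$, and $\dim\operatorname{rec}F$ is the dimension of the linear span of $\operatorname{rec}F$. Formulas: $\eta(a,b):\equiv a\ne b\wedge\exists c\,\bigl(B(a,b,c)\wedge\forall d\,(B(a,c,d)\to d=c)\bigr)$. $H_1(z;x_1):\equiv z=x_1$, $H_r(z;x_1,\dots,x_r):\equiv\exists w\,(H_{r-1}(w;x_2,\dots,x_r)\wedge B(x_1,z,w))$, and for $m\ge2$, $\operatorname{Dep}_m(x_1,\dots,x_m):\equiv\bigvee_{\{1,\dots,m\}=I\sqcup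 J,\ I,J\ne\emptyset}\exists z\,(H_{|I|}(z;\bar x_I)\wedge H_{|J|}(z;\bar x_J))$. Then $$\rho_k:\equiv\exists a\,\exists b_1\cdots\exists b_k\,\Bigl(\neg\operatorname{Dep}_{k+1}(a,b_1,\dots,b_k)\wedge\bigwedge_{i=1}^k\neg\eta(a,b_i)\Bigr),$$ $$\lambda_k:\equiv\exists a\,\exists b_1\cdots\exists b_k\,\Bigl(\neg\operatorname{Dep}_{k+1}(a,b_1,\dots,b_k)\wedge\bigwedge_{i=1}^k\bigl(\neg\eta(a,b_i)\wedge\neg\eta(b_i,a)\bigr)\Bigr),$$ $$\varepsilon:\equiv\exists a\,\exists b\,\bigl(\neg\eta(a,b)\wedge\eta(b,a)\bigr).$$ *)

theory Defs
  imports "HOL-Analysis.Analysis"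
begin

section \<open>First-order logic of betweenness\<close>

text \<open>
  Formulas of the first-order language with one ternary relation symbol.
  Variables are de Bruijn indices: under a quantifier, index 0 is the newly bound
  variable and the index of every variable of the surrounding context goes up by one.
\<close>

datatype fm =
    Bot
  | Eq nat nat
  | Btw nat nat nat
  | Neg fm
  | Conj fm fm
  | Disj fm fm
  | Imp fm fm
  | Ex fm
  | All fm

primrec vars_below :: "nat \<Rightarrow> fm \<Rightarrow> bool" where
  "vars_below n Bot \<longleftrightarrow> True"
| "vars_below n (Eq i j) \<longleftrightarrow> i < n \<and> j < n"
| "vars_below n (Btw i j k) \<longleftrightarrow> i < n \<and> j < n \<and> k < n"
| "vars_below n (Neg \<phi>) \<longleftrightarrow> vars_below n \<phi>"
| "vars_below n (Conj \<phi> \<psi>) \<longleftrightarrow> vars_below n \<phi> \<and> vars_below n \<psi>"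
| "vars_below n (Disj \<phi> \<psi>) \<longleftrightarrow> vars_below n \<phi> \<and> vars_below n \<psi>"
| "vars_below n (Imp \<phi> \<psi>) \<longleftrightarrow> vars_below n \<phi> \<and> vars_below n \<psi>"
| "vars_below n (Ex \<phi>) \<longleftrightarrow> vars_below (Suc n) \<phi>"
| "vars_below n (All \<phi>) \<longleftrightarrow> vars_below (Suc n) \<phi>"

definition sentence :: "fm \<Rightarrow> bool" where
  "sentence \<phi> \<longleftrightarrow> vars_below 0 \<phi>"

primrec sat :: "'a set \<Rightarrow> ('a \<Rightarrow> 'a \<Rightarrow> 'a \<Rightarrow> bool) \<Rightarrow> (nat \<Rightarrow> 'a) \<Rightarrow> fm \<Rightarrow> bool" where
  "sat U R e Bot \<longleftrightarrow> False"
| "sat U R e (Eq i j) \<longleftrightarrow> e i = e j"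
| "sat U R e (Btw i j k) \<longleftrightarrow> R (e i) (e j) (e k)"
| "sat U R e (Neg \<phi>) \<longleftrightarrow> \<not> sat U R e \<phi>"
| "sat U R e (Conj \<phi> \<psi>) \<longleftrightarrow> sat U R e \<phi> \<and> sat U R e \<psi>"
| "sat U R e (Disj \<phi> \<psi>) \<longleftrightarrow> sat U R e \<phi> \<or> sat U R e \<psi>"
| "sat U R e (Imp \<phi> \<psi>) \<longleftrightarrow> (sat U R e \<phi> \<longrightarrow> sat U R e \<psi>)"
| "sat U R e (Ex \<phi>) \<longleftrightarrow> (\<exists>a\<in>U. sat U R (case_nat a e) \<phi>)"
| "sat U R e (All \<phi>) \<longleftrightarrow> (\<forall>a\<in>U. sat U R (case_nat a e) \<phi>)"

definition between :: "'a::real_vector \<Rightarrow> 'a \<Rightarrow> 'a \<Rightarrow> bool" where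
  "between a x b \<longleftrightarrow> x \<in> closed_segment a b"

definition models :: "'a::real_vector set \<Rightarrow> fm \<Rightarrow> bool" (infix "\<Turnstile>" 50) where
  "K \<Turnstile> \<phi> \<longleftrightarrow> (\<forall>e. range e \<subseteq> K \<longrightarrow> sat K between e \<phi>)"

definition theory_of :: "'a::real_vector set \<Rightarrow> fm set" where
  "theory_of K = {\<phi>. sentence \<phi> \<and> K \<Turnstile> \<phi>}"

definition elem_equiv :: "'a::real_vector set \<Rightarrow> 'b::real_vector set \<Rightarrow> bool" where
  "elem_equiv K L \<longleftrightarrow> theory_of K = theory_of L"


section \<open>The formulas\<close>

definition conjs :: "fm list \<Rightarrow> fm" where
  "conjs \<phi>s = foldr Conj \<phi>s (Neg Bot)"

definition disjs :: "fm list \<Rightarrow> fm" where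
  "disjs \<phi>s = foldr Disj \<phi>s Bot"

text \<open>
  The functions below take variables as arguments. In \<open>eta\<close>, the first quantifier
  binds \<open>c\<close> and the second binds \<open>d\<close>, so in the innermost scope \<open>d\<close> is 0, \<open>c\<close> is 1.
\<close>

definition eta :: "nat \<Rightarrow> nat \<Rightarrow> fm" where
  "eta a b = Conj (Neg (Eq a b))
     (Ex (Conj (Btw (a + 1) (b + 1) 0)
               (All (Imp (Btw (a + 2) 1 0) (Eq 0 1)))))"

text \<open>The clause for the empty list is a dummy; \<open>Dep\<close> below never uses it.\<close>

fun H :: "nat \<Rightarrow> nat list \<Rightarrow> fm" where
  "H z [] = Bot"
| "H z [x] = Eq z x"
| "H z (x # y # ys) = Ex (Conj (H 0 (map Suc (y # ys))) (Btw (Suc x) (Suc z) 0))"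

text \<open>
  \<open>Dep [x\<^sub>1, \<dots>, x\<^sub>m]\<close>: the list positions are numbered from 0, \<open>I\<close> runs through the
  nonempty proper subsets of \<open>{..<m}\<close>, \<open>J\<close> is its complement, and \<open>nths xs I\<close> is the
  subtuple with positions in \<open>I\<close>, in increasing order.
\<close>

definition Dep :: "nat list \<Rightarrow> fm" where
  "Dep xs = disjs
     [Ex (Conj (H 0 (map Suc (nths xs I))) (H 0 (map Suc (nths xs ({..<length xs} - I))))).
        I \<leftarrow> map set (subseqs [0..<length xs]), I \<noteq> {}, {..<length xs} - I \<noteq> {}]"

text \<open>
  In the scope of the quantifier block \<open>\<exists>a b\<^sub>1 \<dots> b\<^sub>k\<close>, the variable \<open>a\<close> is \<open>k\<close>
  and \<open>b\<^sub>i\<close> is \<open>k - i\<close>.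
\<close>

definition rho :: "nat \<Rightarrow> fm" where
  "rho k = (let a = k; bs = map (\<lambda>i. k - i) [1..<Suc k] in
     (Ex ^^ Suc k) (Conj (Neg (Dep (a # bs)))
       (conjs (map (\<lambda>b. Neg (eta a b)) bs))))"

definition lambda :: "nat \<Rightarrow> fm" where
  "lambda k = (let a = k; bs = map (\<lambda>i. k - i) [1..<Suc k] in
     (Ex ^^ Suc k) (Conj (Neg (Dep (a # bs)))
       (conjs (map (\<lambda>b. Conj (Neg (eta a b)) (Neg (eta b a))) bs))))"

definition epsilon :: fm where
  "epsilon = Ex (Ex (Conj (Neg (eta 1 0)) (eta 0 1)))"


section \<open>Recession cone and lineality space\<close>

definition rec_cone :: "'a::real_vector set \<Rightarrow> 'a set" where
  "rec_cone F = {v. \<forall>x\<in>F. \<forall>t\<ge>0. x + t *\<^sub>R v \<in> F}"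

definition lin_space :: "'a::real_vector set \<Rightarrow> 'a set" where
  "lin_space F = rec_cone F \<inter> uminus ` rec_cone F"

end

theory Submission imports Defs begin

text \<open>
  For points \<open>a\<close>, \<open>b\<close> of a closed convex set \<open>F\<close>, the formula \<open>\<eta>(a, b)\<close> says that the ray from
  \<open>a\<close> through \<open>b\<close> leaves \<open>F\<close>, that is, \<open>b - a\<close> is not a recession direction: a ray contained in
  a closed convex set can be translated to start at any of its points. By Radon's theorem \<open>Dep\<close>
  expresses affine dependence of a finite family. Hence \<open>\<rho>\<^sub>k\<close> and \<open>\<lambda>\<^sub>k\<close> assert that there are \<open>k\<close>
  linearly independent vectors \<open>b\<^sub>i - a\<close> in \<open>rec F\<close>, respectively \<open>lin F\<close>. The affine dimension
  is read off from the sentences stating the existence of \<open>k + 1\<close> affinely independent points.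
\<close>

section \<open>Semantics of the formulas\<close>

lemma sat_conjs: "sat U R e (conjs \<phi>s) \<longleftrightarrow> (\<forall>\<phi>\<in>set \<phi>s. sat U R e \<phi>)"
  by (induction \<phi>s) (auto simp: conjs_def)

lemma sat_disjs: "sat U R e (disjs \<phi>s) \<longleftrightarrow> (\<exists>\<phi>\<in>set \<phi>s. sat U R e \<phi>)"
  by (induction \<phi>s) (auto simp: disjs_def)

lemma range_case_nat: "a \<in> U \<Longrightarrow> range e \<subseteq> U \<Longrightarrow> range (case_nat a e) \<subseteq> U"
  by (auto simp: image_subset_iff split: nat.split)

text \<open>The \<open>n\<close> nested \<open>case_nat\<close> updates merge into one environment
  \<open>f\<close>: bound values occupy the indices below \<open>n\<close>, the innermost quantifier
  at 0, and \<open>e\<close> follows shifted by \<open>n\<close>.\<close>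

lemma sat_Ex_pow:
  "sat U R e ((Ex ^^ n) \<phi>) \<longleftrightarrow>
    (\<exists>f. (\<forall>i<n. f i \<in> U) \<and> (\<forall>i. f (i + n) = e i) \<and> sat U R f \<phi>)"
proof (induction n arbitrary: e)
  case 0
  have "(\<forall>i. f i = e i) \<longleftrightarrow> f = e" for f
    by auto
  then show ?case by simp
next
  case (Suc n)
  \<comment> \<open>The outermost bound value is pushed up by the other \<open>n\<close>
    quantifiers, so \<open>a = f n\<close>.\<close>
  have "(\<exists>a\<in>U. (\<forall>i<n. f i \<in> U) \<and> (\<forall>i. f (i + n) = case_nat a e i)) \<longleftrightarrow>
      (\<forall>i<Suc n. f i \<in> U) \<and> (\<forall>i. f (i + Suc n) = e i)" for f
  proof
    assume "\<exists>a\<in>U. (\<forall>i<n. f i \<in> U) \<and> (\<forall>i. f (i + n) = case_nat a e i)"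
    then obtain a where a: "a \<in> U" "\<forall>i<n. f i \<in> U" "\<And>i. f (i + n) = case_nat a e i"
      by blast
    have "f n \<in> U" using a(3)[of 0] a(1) by simp
    moreover have "f (i + Suc n) = e i" for i using a(3)[of "Suc i"] by simp
    ultimately show "(\<forall>i<Suc n. f i \<in> U) \<and> (\<forall>i. f (i + Suc n) = e i)"
      using a(2) by (auto simp: less_Suc_eq)
  next
    assume "(\<forall>i<Suc n. f i \<in> U) \<and> (\<forall>i. f (i + Suc n) = e i)"
    then show "\<exists>a\<in>U. (\<forall>i<n. f i \<in> U) \<and> (\<forall>i. f (i + n) = case_nat a e i)"
      by (intro bexI[of _ "f n"]) (auto split: nat.splits)
  qed
  note shift = this
  have "sat U R e ((Ex ^^ Suc n) \<phi>) \<longleftrightarrow>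
      (\<exists>f. (\<exists>a\<in>U. (\<forall>i<n. f i \<in> U) \<and> (\<forall>i. f (i + n) = case_nat a e i)) \<and> sat U R f \<phi>)"
    unfolding funpow.simps comp_apply sat.simps Suc.IH by blast
  then show ?case by (simp only: shift) blast
qed

text \<open>Only the first \<open>n\<close> entries matter to the body, so the assignment quantified
  over in \<open>models\<close> has no influence on the truth of the block.\<close>

lemma models_Ex_pow:
  assumes "F \<noteq> {}"
    and sat: "\<And>e. range e \<subseteq> F \<Longrightarrow> sat F between e \<phi> \<longleftrightarrow> P e"
    and cong: "\<And>f g. (\<And>i. i < n \<Longrightarrow> f i = g i) \<Longrightarrow> P f \<longleftrightarrow> P g"
  shows "F \<Turnstile> (Ex ^^ n) \<phi> \<longleftrightarrow> (\<exists>e. e ` {..<n} \<subseteq> F \<and> P e)"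
proof -
  have eq: "sat F between e ((Ex ^^ n) \<phi>) \<longleftrightarrow> (\<exists>g. g ` {..<n} \<subseteq> F \<and> P g)" if e: "range e \<subseteq> F" for e
  proof
    assume "sat F between e ((Ex ^^ n) \<phi>)"
    then obtain f where f: "\<forall>i<n. f i \<in> F" "\<forall>i. f (i + n) = e i" "sat F between f \<phi>"
      unfolding sat_Ex_pow by blast
    have "f i \<in> F" for i
      using f(1,2) e by (cases "i < n") (auto simp: not_less dest!: le_Suc_ex simp: add.commute)
    then show "\<exists>g. g ` {..<n} \<subseteq> F \<and> P g"
      using f sat[of f] by blast
  next
    assume "\<exists>g. g ` {..<n} \<subseteq> F \<and> P g"
    then obtain g where g: "g ` {..<n} \<subseteq> F" "P g" by blast
    \<comment> \<open>Continuing with \<open>e\<close> after the block keeps all values in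
      \<open>F\<close>; \<open>cong\<close> carries \<open>P\<close> over from
      \<open>g\<close>.\<close>
    define f where "f i = (if i < n then g i else e (i - n))" for i
    have "range f \<subseteq> F" using g(1) e by (auto simp: f_def)
    moreover have "P f" using cong[of f g] g(2) by (simp add: f_def)
    ultimately show "sat F between e ((Ex ^^ n) \<phi>)"
      unfolding sat_Ex_pow using sat[of f] g(1) by (intro exI[of _ f]) (auto simp: f_def)
  qed
  \<comment> \<open>A constant assignment keeps the universal quantifier in \<open>models\<close>
    from being vacuous.\<close>
  obtain x where "x \<in> F" using assms(1) by blast
  then have "range (\<lambda>_. x) \<subseteq> F" by auto
  then show ?thesis unfolding models_def using eq by blast
qed

text \<open>\<open>H\<close> builds a hull one vertex at a time: the hull of a point and a nonempty
  set is the union of the segments from the point to the hull of the set.\<close>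

lemma sat_H:
  assumes "convex F" "range e \<subseteq> F" "xs \<noteq> []"
  shows "sat F between e (H z xs) \<longleftrightarrow> e z \<in> convex hull (e ` set xs)"
  using assms(2,3)
proof (induction z xs arbitrary: e rule: H.induct)
  case (3 z x y ys)
  let ?S = "e ` set (y # ys)"
  \<comment> \<open>The witness in \<open>H\<close> ranges over \<open>F\<close>; as
    \<open>F\<close> contains the hull, none is lost.\<close>
  have sub: "convex hull ?S \<subseteq> F"
    using 3(2) by (intro hull_minimal assms(1)) auto
  have IH: "sat F between (case_nat w e) (H 0 (map Suc (y # ys))) \<longleftrightarrow> w \<in> convex hull ?S"
    if "w \<in> F" for w
    using 3(1)[OF range_case_nat[OF that 3(2)]] by (simp add: image_image)
  have "convex hull (e ` set (x # y # ys)) = (\<Union>w\<in>convex hull ?S. closed_segment (e x) w)"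
    using convex_hull_insert_segments[of "e x" ?S] by simp
  moreover have "sat F between e (H z (x # y # ys)) \<longleftrightarrow>
      (\<exists>w\<in>F. w \<in> convex hull ?S \<and> e z \<in> closed_segment (e x) w)"
    using IH by (auto simp: between_def)
  ultimately show ?case using sub by blast
qed auto

text \<open>Radon's theorem and its converse for families, where a repeated point counts as a dependence.\<close>

lemma Radon_partition_family:
  fixes p :: "'i \<Rightarrow> 'a::euclidean_space"
  assumes "finite K"
  shows "(\<exists>I\<subseteq>K. I \<noteq> {} \<and> K - I \<noteq> {} \<and> convex hull (p ` I) \<inter> convex hull (p ` (K - I)) \<noteq> {})
    \<longleftrightarrow> \<not> (inj_on p K \<and> \<not> affine_dependent (p ` K))"
    (is "(\<exists>I\<subseteq>K. ?R I) \<longleftrightarrow> _")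
proof
  assume "\<exists>I\<subseteq>K. ?R I"
  then obtain I where I: "I \<subseteq> K" "?R I" by blast
  show "\<not> (inj_on p K \<and> \<not> affine_dependent (p ` K))"
  proof
    assume A: "inj_on p K \<and> \<not> affine_dependent (p ` K)"
    \<comment> \<open>For affinely independent points the hulls meet in the hull of the common
      vertices, and injectivity leaves no common vertex.\<close>
    have "p ` I \<union> p ` (K - I) = p ` K" using I(1) by blast
    then have "convex hull (p ` I \<inter> p ` (K - I)) = convex hull (p ` I) \<inter> convex hull (p ` (K - I))"
      using A by (intro convex_hull_Int) simp
    moreover have "p ` I \<inter> p ` (K - I) = {}"
      using A I(1) by (auto dest!: inj_onD)
    ultimately show False using I(2) by simp
  qed
next
  assume A: "\<not> (inj_on p K \<and> \<not> affine_dependent (p ` K))"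
  show "\<exists>I\<subseteq>K. ?R I"
  proof (cases "inj_on p K")
    case False
    then obtain i j where ij: "i \<in> K" "j \<in> K" "i \<noteq> j" "p i = p j"
      by (auto simp: inj_on_def)
    \<comment> \<open>Splitting off one index of a repeated point leaves the point on both
      sides.\<close>
    have "p i \<in> convex hull (p ` {i}) \<inter> convex hull (p ` (K - {i}))"
      using ij by (auto intro!: hull_inc)
    then show ?thesis using ij by (intro exI[of _ "{i}"]) blast
  next
    case True
    then obtain M N where MN: "M \<inter> N = {}" "M \<union> N = p ` K" "convex hull M \<inter> convex hull N \<noteq> {}"
      using Radon_partition[of "p ` K"] A assms by blast
    \<comment> \<open>Radon's partition of the points is pulled back to the indices.\<close>
    define I where "I = {i \<in> K. p i \<in> M}"
    have mem: "x \<in> M \<or> x \<in> N \<longleftrightarrow> x \<in> p ` K" for x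
      using MN(2) by blast
    have "p ` I = M" using mem by (fastforce simp: I_def)
    moreover have "p ` (K - I) = N" using mem MN(1) by (fastforce simp: I_def)
    moreover have "M \<noteq> {}" "N \<noteq> {}" using MN(3) by auto
    ultimately have "?R I" using MN(3) by auto
    then show ?thesis by (intro exI[of _ I]) (auto simp: I_def)
  qed
qed

text \<open>\<open>Dep\<close> is the Radon condition for the family indexed by list positions;
  distinctness of \<open>xs\<close> lets positions be replaced by variables in the injectivity
  condition.\<close>

lemma sat_Dep:
  fixes F :: "'a::euclidean_space set"
  assumes "convex F" "range e \<subseteq> F" "distinct xs"
  shows "sat F between e (Dep xs) \<longleftrightarrow> \<not> (inj_on e (set xs) \<and> \<not> affine_dependent (e ` set xs))"
proof -
  let ?K = "{..<length xs}"
  define p where "p i = e (xs ! i)" for i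
  have img: "e ` set (nths xs I) = p ` I" if "I \<subseteq> ?K" for I
    using that by (force simp: set_nths p_def)
  have H: "sat F between e (Ex (Conj (H 0 (map Suc (nths xs I))) (H 0 (map Suc (nths xs (?K - I))))))
      \<longleftrightarrow> convex hull (p ` I) \<inter> convex hull (p ` (?K - I)) \<noteq> {}"
    if I: "I \<subseteq> ?K" "I \<noteq> {}" "?K - I \<noteq> {}" for I
  proof -
    have ne: "nths xs J \<noteq> []" if "J \<subseteq> ?K" "J \<noteq> {}" for J
      using img[OF that(1)] that(2) by auto
    have "sat F between (case_nat w e) (H 0 (map Suc (nths xs J))) \<longleftrightarrow> w \<in> convex hull (p ` J)"
      if "w \<in> F" "J \<subseteq> ?K" "J \<noteq> {}" for w J
      using sat_H[OF assms(1) range_case_nat[OF that(1) assms(2)], of "map Suc (nths xs J)" 0]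
        ne[OF that(2,3)] img[OF that(2)]
      by (simp add: image_image)
    \<comment> \<open>Common points of the two hulls thus lie in the range of the
      quantifier.\<close>
    moreover have "convex hull (p ` I) \<subseteq> F"
      using assms(2) by (intro hull_minimal assms(1)) (auto simp: p_def)
    ultimately show ?thesis using I by auto
  qed
  have "sat F between e (Dep xs) \<longleftrightarrow>
      (\<exists>I\<subseteq>?K. I \<noteq> {} \<and> ?K - I \<noteq> {} \<and> convex hull (p ` I) \<inter> convex hull (p ` (?K - I)) \<noteq> {})"
  proof -
    have "sat F between e (Dep xs) \<longleftrightarrow> (\<exists>I\<in>set ` set (subseqs [0..<length xs]).
        I \<noteq> {} \<and> ?K - I \<noteq> {} \<and>
        sat F between e (Ex (Conj (H 0 (map Suc (nths xs I))) (H 0 (map Suc (nths xs (?K - I)))))))"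
      unfolding Dep_def sat_disjs by (simp del: sat.simps) blast
    also have "set ` set (subseqs [0..<length xs]) = Pow ?K"
      by (simp add: subseqs_powset atLeast0LessThan)
    finally have "sat F between e (Dep xs) \<longleftrightarrow> (\<exists>I\<subseteq>?K. I \<noteq> {} \<and> ?K - I \<noteq> {} \<and>
        sat F between e (Ex (Conj (H 0 (map Suc (nths xs I))) (H 0 (map Suc (nths xs (?K - I)))))))"
      by (simp only: Bex_def Pow_iff)
    also have "\<dots> \<longleftrightarrow>
      (\<exists>I\<subseteq>?K. I \<noteq> {} \<and> ?K - I \<noteq> {} \<and> convex hull (p ` I) \<inter> convex hull (p ` (?K - I)) \<noteq> {})"
      using H by (intro ex_cong1 conj_cong refl)
    finally show ?thesis .
  qed
  also have "\<dots> \<longleftrightarrow> \<not> (inj_on p ?K \<and> \<not> affine_dependent (p ` ?K))"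
    by (rule Radon_partition_family) simp
  also have "inj_on p ?K \<longleftrightarrow> inj_on e (set xs)"
  proof -
    have b: "bij_betw ((!) xs) ?K (set xs)" by (rule bij_betw_nth) (use assms(3) in auto)
    have "p = e \<circ> (!) xs" by (auto simp: p_def)
    then show ?thesis
      using comp_inj_on_iff[of "(!) xs" ?K e] b by (simp add: bij_betw_def)
  qed
  also have "p ` ?K = e ` set xs"
    using img[of ?K] by (simp add: nths_all)
  finally show ?thesis .
qed

section \<open>Recession directions\<close>

text \<open>Segments from \<open>x\<close> to ever farther points of the given ray turn towards
  direction \<open>v\<close>; closedness keeps the limit in \<open>F\<close>.\<close>

lemma ray_imp_rec_cone:
  fixes F :: "'a::real_normed_vector set"
  assumes "closed F" "convex F" "\<And>t. 0 \<le> t \<Longrightarrow> a + t *\<^sub>R v \<in> F"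
  shows "v \<in> rec_cone F"
  unfolding rec_cone_def
proof (intro CollectI ballI allI impI)
  fix x and t :: real assume x: "x \<in> F" and t: "0 \<le> t"
  \<comment> \<open>The point at fraction \<open>1 / (n + 1)\<close> of the segment from
    \<open>x\<close> to \<open>a + ((n + 1) * t) *\<^sub>R v\<close>.\<close>
  define s where "s n = x + t *\<^sub>R v + inverse (real (Suc n)) *\<^sub>R (a - x)" for n
  have "s n \<in> F" for n
  proof -
    let ?u = "inverse (real (Suc n))"
    have "(1 - ?u) *\<^sub>R x + ?u *\<^sub>R (a + (real (Suc n) * t) *\<^sub>R v) \<in> F"
      using x t assms(3) by (intro convexD_alt[OF assms(2)]) (auto intro: inverse_le_1_iff[THEN iffD2])
    moreover have "?u * (real (Suc n) * t) = t" by simp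
    ultimately show ?thesis
      unfolding s_def by (simp add: algebra_simps del: of_nat_Suc)
  qed
  moreover have "s \<longlonglongrightarrow> x + t *\<^sub>R v + 0 *\<^sub>R (a - x)"
    unfolding s_def by (intro tendsto_intros LIMSEQ_inverse_real_of_nat)
  ultimately show "x + t *\<^sub>R v \<in> F"
    using closed_sequentially[OF assms(1), of s] by simp
qed

section \<open>Algebra of the recession cone\<close>

lemma rec_coneD: "v \<in> rec_cone F \<Longrightarrow> x \<in> F \<Longrightarrow> x + v \<in> F"
  by (force simp: rec_cone_def dest: bspec spec[of _ 1])

lemma rec_cone_scaleR: "v \<in> rec_cone F \<Longrightarrow> 0 \<le> c \<Longrightarrow> c *\<^sub>R v \<in> rec_cone F"
  by (auto simp: rec_cone_def)

lemma zero_in_rec_cone: "0 \<in> rec_cone F"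
  by (simp add: rec_cone_def)

lemma rec_cone_add: "v \<in> rec_cone F \<Longrightarrow> w \<in> rec_cone F \<Longrightarrow> v + w \<in> rec_cone F"
  by (simp add: rec_cone_def scaleR_add_right flip: add.assoc)

lemma lin_space_iff: "v \<in> lin_space F \<longleftrightarrow> v \<in> rec_cone F \<and> - v \<in> rec_cone F"
  unfolding lin_space_def by (auto intro: image_eqI[of _ _ "- v"])

text \<open>The recession cone is closed under addition and nonnegative scaling, so only negation
  separates it from a subspace.\<close>

lemma subspace_rec_cone_iff: "subspace (rec_cone F) \<longleftrightarrow> rec_cone F = lin_space F"
proof
  assume "subspace (rec_cone F)"
  then show "rec_cone F = lin_space F"
    by (auto simp: lin_space_iff subspace_neg)
next
  assume eq: "rec_cone F = lin_space F"
  have "c *\<^sub>R v \<in> rec_cone F" if "v \<in> rec_cone F" for c v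
  proof (cases "0 \<le> c")
    case False
    have "- v \<in> rec_cone F" using that eq lin_space_iff by blast
    then have "(- c) *\<^sub>R (- v) \<in> rec_cone F" by (rule rec_cone_scaleR) (use False in simp)
    then show ?thesis by simp
  qed (use that rec_cone_scaleR in auto)
  then show "subspace (rec_cone F)"
    by (simp add: subspace_def zero_in_rec_cone rec_cone_add)
qed

text \<open>The left side is the meaning of \<open>eta\<close>, with \<open>c\<close> the last point
  of \<open>F\<close> on the ray from \<open>a\<close> through \<open>b\<close>. Such a point exists
  exactly when the ray leaves \<open>F\<close>.\<close>

lemma ray_leaves_iff:
  fixes F :: "'a::real_normed_vector set"
  assumes "closed F" "convex F" "a \<in> F" "b \<in> F"
  shows "a \<noteq> b \<and> (\<exists>c\<in>F. b \<in> closed_segment a c \<and> (\<forall>d\<in>F. c \<in> closed_segment a d \<longrightarrow> d = c))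
    \<longleftrightarrow> b - a \<notin> rec_cone F" (is "?L \<longleftrightarrow> _")
proof
  assume ?L
  then obtain c where c: "a \<noteq> b" "c \<in> F" "b \<in> closed_segment a c"
    "\<And>d. d \<in> F \<Longrightarrow> c \<in> closed_segment a d \<Longrightarrow> d = c" by blast
  then obtain u where u: "0 \<le> u" "b = (1 - u) *\<^sub>R a + u *\<^sub>R c"
    by (auto simp: in_segment)
  have ba: "b - a = u *\<^sub>R (c - a)" using u(2) by (simp add: algebra_simps)
  then have nz: "u \<noteq> 0" "c \<noteq> a" using c(1) by auto
  show "b - a \<notin> rec_cone F"
  proof
    assume "b - a \<in> rec_cone F"
    then have "inverse u *\<^sub>R (b - a) \<in> rec_cone F" using u(1) by (intro rec_cone_scaleR) auto
    \<comment> \<open>Reflecting \<open>a\<close> in \<open>c\<close> gives a point of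
      \<open>F\<close> beyond \<open>c\<close>, against the maximality of \<open>c\<close>.\<close>
    then have "c + (c - a) \<in> F" using c(2) nz(1) unfolding ba by (intro rec_coneD) auto
    moreover have "c \<in> closed_segment a (c + (c - a))"
      unfolding in_segment by (intro exI[of _ "1/2"]) (simp add: algebra_simps flip: scaleR_2)
    ultimately have "c + (c - a) = c" by (rule c(4))
    then show False using nz(2) by simp
  qed
next
  assume nr: "b - a \<notin> rec_cone F"
  then have ab: "a \<noteq> b" using zero_in_rec_cone by force
  obtain t0 where t0: "0 \<le> t0" "a + t0 *\<^sub>R (b - a) \<notin> F"
    using ray_imp_rec_cone[OF assms(1,2)] nr by blast
  \<comment> \<open>The parameters of the ray's points in \<open>F\<close>: by convexity an interval
    starting at 0, bounded by \<open>t0\<close> and closed, so its supremum yields the last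
    point.\<close>
  define T where "T = {t. 0 \<le> t \<and> a + t *\<^sub>R (b - a) \<in> F}"
  have below: "s \<in> T" if "t \<in> T" "0 \<le> s" "s \<le> t" for s t
  proof (cases "t = 0")
    case False
    then have t: "0 < t" using that by simp
    have "(1 - s / t) *\<^sub>R a + (s / t) *\<^sub>R (a + t *\<^sub>R (b - a)) \<in> F"
      using that t assms(3) by (intro convexD_alt[OF assms(2)]) (auto simp: T_def)
    then show ?thesis using t that by (simp add: T_def algebra_simps)
  qed (use that in auto)
  have bdd: "t \<le> t0" if "t \<in> T" for t
    using below[OF that, of t0] t0 by (force simp: T_def)
  have "closed T"
  proof -
    have "T = {0..} \<inter> (\<lambda>t. a + t *\<^sub>R (b - a)) -` F" by (auto simp: T_def)
    moreover have "closed ((\<lambda>t. a + t *\<^sub>R (b - a)) -` F)"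
      by (intro closed_vimage assms(1) continuous_intros)
    ultimately show ?thesis by (simp add: closed_Int)
  qed
  moreover have "1 \<in> T" using assms(4) by (simp add: T_def)
  moreover have bT: "bdd_above T" using bdd by (auto simp: bdd_above_def)
  ultimately have supT: "Sup T \<in> T" and ge1: "1 \<le> Sup T"
    by (auto intro: closed_contains_Sup cSup_upper)
  define c where "c = a + Sup T *\<^sub>R (b - a)"
  have "c \<in> F" using supT by (simp add: c_def T_def)
  moreover have "b \<in> closed_segment a c"
    unfolding in_segment using ge1
    by (intro exI[of _ "inverse (Sup T)"]) (auto simp: c_def algebra_simps inverse_le_1_iff)
  moreover have "d = c" if d: "d \<in> F" "c \<in> closed_segment a d" for d
  proof -
    obtain u where u: "0 \<le> u" "u \<le> 1" "c = (1 - u) *\<^sub>R a + u *\<^sub>R d"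
      using d(2) by (auto simp: in_segment)
    have e: "Sup T *\<^sub>R (b - a) = u *\<^sub>R (d - a)"
      using u(3) by (simp add: c_def algebra_simps)
    have "u \<noteq> 0" using e ab ge1 by auto
    \<comment> \<open>A point \<open>d\<close> beyond \<open>c\<close> has parameter
      \<open>Sup T / u\<close> in \<open>T\<close>, which forces \<open>u = 1\<close>.\<close>
    then have d': "d = a + (Sup T / u) *\<^sub>R (b - a)"
    proof -
      have "(Sup T / u) *\<^sub>R (b - a) = inverse u *\<^sub>R (Sup T *\<^sub>R (b - a))"
        by (simp add: field_simps)
      also have "\<dots> = d - a" using e \<open>u \<noteq> 0\<close> by simp
      finally show ?thesis by simp
    qed
    then have "Sup T / u \<in> T" using d(1) u(1) ge1 by (simp add: T_def)
    then have "Sup T / u \<le> Sup T" using bT by (intro cSup_upper)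
    then have "Sup T \<le> Sup T * u" using \<open>u \<noteq> 0\<close> u(1) by (simp add: field_simps)
    then have "u = 1" using ge1 u(2) by (simp add: mult_le_cancel_left1)
    then show "d = c" using d' by (simp add: c_def)
  qed
  ultimately show ?L using ab by blast
qed

lemma sat_eta:
  fixes F :: "'a::real_normed_vector set"
  assumes "closed F" "convex F" "range e \<subseteq> F"
  shows "sat F between e (eta i j) \<longleftrightarrow> e j - e i \<notin> rec_cone F"
proof -
  have "e i \<in> F" "e j \<in> F" using assms(3) by auto
  from ray_leaves_iff[OF assms(1,2) this] show ?thesis
    by (simp add: eta_def between_def numeral_2_eq_2 eq_commute[of _ "_::'a"])
qed

section \<open>The sentences and the dimensions\<close>

text \<open>Translating by the base point \<open>e k\<close> turns affine independence into linear
  independence of the differences. \<open>V\<close> stands for the recession cone or the lineality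
  space.\<close>

lemma independent_differences_iff:
  fixes V :: "'a::euclidean_space set"
  assumes "F \<noteq> {}" and add: "\<And>x v. x \<in> F \<Longrightarrow> v \<in> V \<Longrightarrow> x + v \<in> F"
  shows "(\<exists>e. e ` {..<Suc k} \<subseteq> F \<and> (inj_on e {..k} \<and> \<not> affine_dependent (e ` {..k}))
      \<and> (\<forall>i<k. e i - e k \<in> V)) \<longleftrightarrow> k \<le> dim V" (is "?L \<longleftrightarrow> _")
proof -
  have at: "{..k} = insert k {..<k}" by auto
  show ?thesis
  proof
    assume ?L
    then obtain e where e: "inj_on e {..k}" "\<not> affine_dependent (e ` {..k})" "\<forall>i<k. e i - e k \<in> V"
      by blast
    let ?B = "(\<lambda>x. - e k + x) ` e ` {..<k}"
    have "e k \<notin> e ` {..<k}" using e(1) by (force simp: inj_on_def)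
    then have "independent ?B"
      using e(2) affine_dependent_iff_dependent[of "e k" "e ` {..<k}"] by (simp add: at)
    moreover have "?B \<subseteq> V" using e(3) by auto
    moreover have "card ?B = k"
    proof -
      have "inj_on e {..<k}" by (rule inj_on_subset[OF e(1)]) auto
      then show ?thesis by (simp add: card_image)
    qed
    ultimately show "k \<le> dim V" using independent_card_le_dim by metis
  next
    assume k: "k \<le> dim V"
    \<comment> \<open>Although \<open>V\<close> may be only a cone, a basis of its span can be
      chosen inside \<open>V\<close>.\<close>
    obtain B where B: "B \<subseteq> V" "independent B" "card B = dim V"
      by (metis basis_exists[of V])
    then obtain C where C: "C \<subseteq> B" "card C = k" "finite C"
      using k by (metis obtain_subset_with_card_n)
    then obtain g where g: "bij_betw g {0..<k} C"
      using ex_bij_betw_nat_finite[of C] by blast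
    have indC: "independent C" using B(2) C(1) by (rule independent_mono)
    obtain a where a: "a \<in> F" using assms(1) by blast
    \<comment> \<open>The base point sits at index \<open>k\<close>, the place of the variable
      \<open>a\<close> in the quantifier block.\<close>
    define e where "e i = (if i < k then a + g i else a)" for i
    have gi: "g i \<in> C" if "i < k" for i using g that by (auto simp: bij_betw_def)
    have gnz: "g i \<noteq> 0" if "i < k" for i using gi[OF that] indC dependent_zero by metis
    have im: "e ` {..<k} = (+) a ` C"
      using g by (force simp: e_def bij_betw_def image_image)
    have nin: "a \<notin> e ` {..<k}" using gnz by (auto simp: e_def)
    have "(\<lambda>x. - a + x) ` e ` {..<k} = C" unfolding im by (simp add: image_image)
    then have "\<not> affine_dependent (insert a (e ` {..<k}))"
      using affine_dependent_iff_dependent[OF nin] indC by simp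
    moreover have "insert a (e ` {..<k}) = e ` {..k}"
      unfolding at image_insert by (simp add: e_def)
    ultimately have "\<not> affine_dependent (e ` {..k})" by simp
    moreover have "inj_on e {..k}"
      unfolding at inj_on_insert
    proof
      show "inj_on e {..<k}" using g by (auto simp: e_def bij_betw_def inj_on_def)
      show "e k \<notin> e ` ({..<k} - {k})" using nin by (auto simp: e_def)
    qed
    moreover have "g i \<in> V" if "i < k" for i using gi[OF that] B(1) C(1) by blast
    then have "e ` {..<Suc k} \<subseteq> F" "\<forall>i<k. e i - e k \<in> V"
      using a add by (auto simp: e_def)
    ultimately show ?L by blast
  qed
qed

lemma affinely_independent_points_iff:
  fixes F :: "'a::euclidean_space set"
  shows "(\<exists>e. e ` {..<Suc k} \<subseteq> F \<and> (inj_on e {..k} \<and> \<not> affine_dependent (e ` {..k})))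
    \<longleftrightarrow> int k \<le> aff_dim F" (is "?L \<longleftrightarrow> _")
proof
  assume ?L
  then obtain e where e: "e ` {..k} \<subseteq> F" "inj_on e {..k}" "\<not> affine_dependent (e ` {..k})"
    by (auto simp: lessThan_Suc_atMost)
  have "int (Suc k) = aff_dim (e ` {..k}) + 1"
    using aff_dim_affine_independent[OF e(3)] e(2) by (simp add: card_image)
  then show "int k \<le> aff_dim F" using aff_dim_subset[OF e(1)] by simp
next
  assume k: "int k \<le> aff_dim F"
  obtain B where B: "B \<subseteq> F" "\<not> affine_dependent B" "of_nat (card B) = aff_dim F + 1"
    using aff_dim_inner_basis_exists by blast
  then have "Suc k \<le> card B" using k by linarith
  then obtain C where C: "C \<subseteq> B" "card C = Suc k" "finite C"
    by (metis obtain_subset_with_card_n)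
  then obtain e where e: "bij_betw e {0..<Suc k} C"
    using ex_bij_betw_nat_finite[of C] by metis
  have "{0..<Suc k} = {..k}" "{..<Suc k} = {..k}" by auto
  then show ?L
    using e B(1) C(1) affine_independent_subset[OF B(2) C(1)]
    by (intro exI[of _ e]) (auto simp: bij_betw_def)
qed

lemma quantifier_block:
  "set (k # map (\<lambda>i. k - i) [1..<Suc k]) = {..k}"
  "set (map (\<lambda>i. k - i) [1..<Suc k]) = {..<k}"
  "distinct (k # map (\<lambda>i. k - i) [1..<Suc k])"
proof -
  show s: "set (map (\<lambda>i. k - i) [1..<Suc k]) = {..<k}"
  proof (intro equalityI subsetI)
    fix j assume "j \<in> {..<k}"
    \<comment> \<open>The variable \<open>j\<close> is the one that stands for \<open>b\<close> with
      subscript \<open>k - j\<close>.\<close>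
    then have "k - j \<in> set [1..<Suc k]" "k - (k - j) = j" by auto
    then show "j \<in> set (map (\<lambda>i. k - i) [1..<Suc k])"
      unfolding set_map by (metis image_eqI)
  qed auto
  then show "set (k # map (\<lambda>i. k - i) [1..<Suc k]) = {..k}" by auto
  show "distinct (k # map (\<lambda>i. k - i) [1..<Suc k])"
    using s by (auto simp: distinct_map inj_on_def)
qed

section \<open>Evaluation of the sentences in a closed convex set\<close>

context
  fixes F :: "'a::euclidean_space set"
  assumes F: "F \<noteq> {}" "closed F" "convex F"
begin

text \<open>The common shape of \<open>rho\<close> and \<open>lambda\<close>:
  \<open>\<psi> i\<close> is the conjunct for variable \<open>i\<close>, tested against the base
  variable \<open>k\<close>.\<close>

lemma models_Ex_independent_differences:
  assumes "\<And>e i. range e \<subseteq> F \<Longrightarrow> sat F between e (\<psi> i) \<longleftrightarrow> e i - e k \<in> V"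
    and "\<And>x v. x \<in> F \<Longrightarrow> v \<in> V \<Longrightarrow> x + v \<in> F"
  shows "F \<Turnstile> (Ex ^^ Suc k) (Conj (Neg (Dep (k # map (\<lambda>i. k - i) [1..<Suc k])))
      (conjs (map \<psi> (map (\<lambda>i. k - i) [1..<Suc k])))) \<longleftrightarrow> k \<le> dim V"
proof -
  have "F \<Turnstile> (Ex ^^ Suc k) (Conj (Neg (Dep (k # map (\<lambda>i. k - i) [1..<Suc k])))
      (conjs (map \<psi> (map (\<lambda>i. k - i) [1..<Suc k])))) \<longleftrightarrow>
    (\<exists>e. e ` {..<Suc k} \<subseteq> F \<and> (inj_on e {..k} \<and> \<not> affine_dependent (e ` {..k}))
      \<and> (\<forall>i<k. e i - e k \<in> V))"
  proof (rule models_Ex_pow[OF F(1)])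
    fix e :: "nat \<Rightarrow> 'a" assume e: "range e \<subseteq> F"
    show "sat F between e (Conj (Neg (Dep (k # map (\<lambda>i. k - i) [1..<Suc k])))
        (conjs (map \<psi> (map (\<lambda>i. k - i) [1..<Suc k])))) \<longleftrightarrow>
      (inj_on e {..k} \<and> \<not> affine_dependent (e ` {..k})) \<and> (\<forall>i<k. e i - e k \<in> V)"
      unfolding sat.simps sat_Dep[OF F(3) e quantifier_block(3)] sat_conjs set_map[of \<psi>]
        quantifier_block(1,2)
      using assms(1)[OF e] by auto
  next
    fix f g :: "nat \<Rightarrow> 'a" assume fg: "\<And>i. i < Suc k \<Longrightarrow> f i = g i"
    then have "f ` {..k} = g ` {..k}" by (intro image_cong) auto
    moreover have "inj_on f {..k} \<longleftrightarrow> inj_on g {..k}" using fg by (intro inj_on_cong) auto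
    ultimately show "((inj_on f {..k} \<and> \<not> affine_dependent (f ` {..k})) \<and> (\<forall>i<k. f i - f k \<in> V)) \<longleftrightarrow>
        ((inj_on g {..k} \<and> \<not> affine_dependent (g ` {..k})) \<and> (\<forall>i<k. g i - g k \<in> V))"
      using fg by simp
  qed
  also have "\<dots> \<longleftrightarrow> k \<le> dim V"
    by (rule independent_differences_iff[OF F(1) assms(2)])
  finally show ?thesis .
qed

lemma models_rho: "F \<Turnstile> rho k \<longleftrightarrow> k \<le> dim (rec_cone F)"
  unfolding rho_def Let_def
  by (rule models_Ex_independent_differences) (simp_all add: sat_eta F rec_coneD)

lemma models_lambda: "F \<Turnstile> lambda k \<longleftrightarrow> k \<le> dim (lin_space F)"
  unfolding lambda_def Let_def
  by (rule models_Ex_independent_differences) (auto simp: sat_eta F rec_coneD lin_space_iff)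

text \<open>With \<open>a\<close> at index 1 and \<open>b\<close> at index 0, the vector
  \<open>b - a\<close> is a recession direction whose negative is not; since
  \<open>lin_space F\<close> lies in \<open>rec_cone F\<close>, this is what makes them
  differ.\<close>

lemma models_epsilon: "F \<Turnstile> epsilon \<longleftrightarrow> rec_cone F \<noteq> lin_space F"
proof -
  have "F \<Turnstile> epsilon \<longleftrightarrow>
    (\<exists>e. e ` {..<2::nat} \<subseteq> F \<and> (e 0 - e 1 \<in> rec_cone F \<and> e 1 - e 0 \<notin> rec_cone F))"
    using models_Ex_pow[of F "Conj (Neg (eta 1 0)) (eta 0 1)"
        "\<lambda>e. e 0 - e 1 \<in> rec_cone F \<and> e 1 - e 0 \<notin> rec_cone F" 2]
    by (simp add: epsilon_def sat_eta F numeral_2_eq_2)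
  also have "\<dots> \<longleftrightarrow> (\<exists>v. v \<in> rec_cone F \<and> - v \<notin> rec_cone F)"
  proof
    assume "\<exists>v. v \<in> rec_cone F \<and> - v \<notin> rec_cone F"
    then obtain v where v: "v \<in> rec_cone F" "- v \<notin> rec_cone F" by blast
    obtain a where a: "a \<in> F" using F(1) by blast
    show "\<exists>e. e ` {..<2::nat} \<subseteq> F \<and> (e 0 - e 1 \<in> rec_cone F \<and> e 1 - e 0 \<notin> rec_cone F)"
      using v a rec_coneD[OF v(1) a]
      by (intro exI[of _ "\<lambda>i::nat. if i = 0 then a + v else a"]) auto
  qed (metis minus_diff_eq)
  also have "\<dots> \<longleftrightarrow> rec_cone F \<noteq> lin_space F"
    using set_eq_iff[of "rec_cone F" "lin_space F"] lin_space_iff[of _ F] by blast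
  finally show ?thesis .
qed

lemma models_Ex_affinely_independent:
  "F \<Turnstile> (Ex ^^ Suc k) (Neg (Dep [0..<Suc k])) \<longleftrightarrow> int k \<le> aff_dim F"
proof -
  have s: "set [0..<Suc k] = {..k}" by auto
  have "F \<Turnstile> (Ex ^^ Suc k) (Neg (Dep [0..<Suc k])) \<longleftrightarrow>
    (\<exists>e. e ` {..<Suc k} \<subseteq> F \<and> (inj_on e {..k} \<and> \<not> affine_dependent (e ` {..k})))"
  proof (rule models_Ex_pow[OF F(1)])
    fix e :: "nat \<Rightarrow> 'a" assume e: "range e \<subseteq> F"
    show "sat F between e (Neg (Dep [0..<Suc k])) \<longleftrightarrow>
        inj_on e {..k} \<and> \<not> affine_dependent (e ` {..k})"
      unfolding sat.simps sat_Dep[OF F(3) e distinct_upt] s by simp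
  next
    fix f g :: "nat \<Rightarrow> 'a" assume fg: "\<And>i. i < Suc k \<Longrightarrow> f i = g i"
    then have "f ` {..k} = g ` {..k}" by (intro image_cong) auto
    moreover have "inj_on f {..k} \<longleftrightarrow> inj_on g {..k}" using fg by (intro inj_on_cong) auto
    ultimately show "(inj_on f {..k} \<and> \<not> affine_dependent (f ` {..k})) \<longleftrightarrow>
        (inj_on g {..k} \<and> \<not> affine_dependent (g ` {..k}))" by simp
  qed
  also have "\<dots> \<longleftrightarrow> int k \<le> aff_dim F" by (rule affinely_independent_points_iff)
  finally show ?thesis .
qed

end

section \<open>Elementary invariance\<close>

lemma vars_below_Ex_pow: "vars_below m ((Ex ^^ n) \<phi>) \<longleftrightarrow> vars_below (m + n) \<phi>"
  by (induction n arbitrary: m) auto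

lemma vars_below_conjs: "vars_below n (conjs \<phi>s) \<longleftrightarrow> (\<forall>\<phi>\<in>set \<phi>s. vars_below n \<phi>)"
  by (induction \<phi>s) (auto simp: conjs_def)

lemma vars_below_disjs: "vars_below n (disjs \<phi>s) \<longleftrightarrow> (\<forall>\<phi>\<in>set \<phi>s. vars_below n \<phi>)"
  by (induction \<phi>s) (auto simp: disjs_def)

lemma vars_below_eta: "vars_below n (eta i j) \<longleftrightarrow> i < n \<and> j < n"
  by (auto simp: eta_def)

lemma vars_below_H: "z < n \<Longrightarrow> set xs \<subseteq> {..<n} \<Longrightarrow> vars_below n (H z xs)"
proof (induction z xs arbitrary: n rule: H.induct)
  case (3 z x y ys)
  have "vars_below (Suc n) (H 0 (map Suc (y # ys)))"
    by (rule "3.IH") (use "3.prems" in auto)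
  then show ?case using "3.prems" by simp
qed auto

lemma vars_below_Dep:
  assumes "set xs \<subseteq> {..<n}"
  shows "vars_below n (Dep xs)"
proof -
  have "vars_below (Suc n) (H 0 (map Suc (nths xs I)))" for I
  proof (rule vars_below_H)
    show "set (map Suc (nths xs I)) \<subseteq> {..<Suc n}"
      using set_nths_subset[of xs I] assms by auto
  qed simp
  then show ?thesis unfolding Dep_def vars_below_disjs by auto
qed

lemma sentence_rho: "sentence (rho k)"
proof -
  have "vars_below (Suc k) (Dep (k # map (\<lambda>i. k - i) [1..<Suc k]))"
    by (rule vars_below_Dep) (use quantifier_block(1) in auto)
  then show ?thesis
    unfolding sentence_def rho_def Let_def vars_below_Ex_pow
    by (auto simp: vars_below_conjs vars_below_eta)
qed

lemma sentence_lambda: "sentence (lambda k)"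
proof -
  have "vars_below (Suc k) (Dep (k # map (\<lambda>i. k - i) [1..<Suc k]))"
    by (rule vars_below_Dep) (use quantifier_block(1) in auto)
  then show ?thesis
    unfolding sentence_def lambda_def Let_def vars_below_Ex_pow
    by (auto simp: vars_below_conjs vars_below_eta)
qed

lemma sentence_epsilon: "sentence epsilon"
  by (simp add: sentence_def epsilon_def vars_below_eta)

lemma sentence_Ex_affinely_independent: "sentence ((Ex ^^ Suc k) (Neg (Dep [0..<Suc k])))"
  unfolding sentence_def vars_below_Ex_pow by (auto intro!: vars_below_Dep simp del: upt_Suc)

section \<open>Transfer between elementarily equivalent sets\<close>

lemma elem_equiv_models: "elem_equiv F G \<Longrightarrow> sentence \<phi> \<Longrightarrow> F \<Turnstile> \<phi> \<longleftrightarrow> G \<Turnstile> \<phi>"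
  by (auto simp: elem_equiv_def theory_of_def)

text \<open>Each dimension is determined by the \<open>k\<close> that it bounds from above, and a
  sentence decides each of these bounds. The ambient spaces may differ.\<close>

lemma elem_equiv_invariants:
  fixes F :: "'a::euclidean_space set" and G :: "'b::euclidean_space set"
  assumes F: "F \<noteq> {}" "closed F" "convex F" and G: "G \<noteq> {}" "closed G" "convex G"
    and eq: "elem_equiv F G"
  shows "dim (rec_cone F) = dim (rec_cone G)" "dim (lin_space F) = dim (lin_space G)"
    "subspace (rec_cone F) \<longleftrightarrow> subspace (rec_cone G)" "aff_dim F = aff_dim G"
proof -
  note transfer = elem_equiv_models[OF eq]
  have "k \<le> dim (rec_cone F) \<longleftrightarrow> k \<le> dim (rec_cone G)" for k
    using transfer[OF sentence_rho] models_rho[OF F] models_rho[OF G] by blast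
  then show "dim (rec_cone F) = dim (rec_cone G)" by (metis order_antisym order_refl)
  have "k \<le> dim (lin_space F) \<longleftrightarrow> k \<le> dim (lin_space G)" for k
    using transfer[OF sentence_lambda] models_lambda[OF F] models_lambda[OF G] by blast
  then show "dim (lin_space F) = dim (lin_space G)" by (metis order_antisym order_refl)
  show "subspace (rec_cone F) \<longleftrightarrow> subspace (rec_cone G)"
    using transfer[OF sentence_epsilon] models_epsilon[OF F] models_epsilon[OF G]
    by (simp add: subspace_rec_cone_iff)
  have "int k \<le> aff_dim F \<longleftrightarrow> int k \<le> aff_dim G" for k
    using transfer[OF sentence_Ex_affinely_independent]
      models_Ex_affinely_independent[OF F] models_Ex_affinely_independent[OF G] by blast
  \<comment> \<open>Nonempty sets have nonnegative affine dimension, so \<open>nat\<close> loses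
    nothing.\<close>
  from this[of "nat (aff_dim F)"] this[of "nat (aff_dim G)"]
  show "aff_dim F = aff_dim G"
    using F(1) G(1) aff_dim_negative_iff[of F] aff_dim_negative_iff[of G] by linarith
qed

theorem theorem10p9:
  fixes F :: "(real ^ 'n) set"
  assumes "2 \<le> CARD('n)"
    and "F \<noteq> {}" and "closed F" and "convex F"
  shows "(\<forall>k\<ge>1. F \<Turnstile> rho k \<longleftrightarrow> k \<le> dim (rec_cone F)) \<and>
    (\<forall>k\<ge>1. F \<Turnstile> lambda k \<longleftrightarrow> k \<le> dim (lin_space F)) \<and>
    (F \<Turnstile> epsilon \<longleftrightarrow> rec_cone F \<noteq> lin_space F) \<and>
    (\<forall>G :: (real ^ 'm) set.
      2 \<le> CARD('m) \<and> G \<noteq> {} \<and> closed G \<and> convex G \<and> elem_equiv F G \<longrightarrow>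
        dim (rec_cone F) = dim (rec_cone G) \<and>
        dim (lin_space F) = dim (lin_space G) \<and>
        (subspace (rec_cone F) \<longleftrightarrow> subspace (rec_cone G)) \<and>
        aff_dim F = aff_dim G)"
proof (intro conjI allI impI)
  fix k :: nat
  show "F \<Turnstile> rho k \<longleftrightarrow> k \<le> dim (rec_cone F)" by (rule models_rho[OF assms(2-4)])
  show "F \<Turnstile> lambda k \<longleftrightarrow> k \<le> dim (lin_space F)" by (rule models_lambda[OF assms(2-4)])
next
  show "F \<Turnstile> epsilon \<longleftrightarrow> rec_cone F \<noteq> lin_space F" by (rule models_epsilon[OF assms(2-4)])
next
  fix G :: "(real ^ 'm) set"
  assume "2 \<le> CARD('m) \<and> G \<noteq> {} \<and> closed G \<and> convex G \<and> elem_equiv F G"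
  then have G: "G \<noteq> {}" "closed G" "convex G" "elem_equiv F G" by auto
  note inv = elem_equiv_invariants[OF assms(2-4) G]
  show "dim (rec_cone F) = dim (rec_cone G)" by (rule inv(1))
  show "dim (lin_space F) = dim (lin_space G)" by (rule inv(2))
  show "subspace (rec_cone F) \<longleftrightarrow> subspace (rec_cone G)" by (rule inv(3))
  show "aff_dim F = aff_dim G" by (rule inv(4))
qed

end
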